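(* For nodes $m,n\in S_t$ of the same stage $t$, let $t_{a(m,n)}$ be the stage of the last common ancestor of $m$ and $n$. In $(AMS_\mu)$ it is sufficient to include the non-anticipativity constraints of the pair $(m,n)$ only for the stage combination $(t,t_{a(m,n)})$; accordingly, the constraints (C) can be replaced by $$x_{im}\ge x_{in}-\bar{x}_i\left(r_{it}-r_{it_{a(m,n)}}\right)\quad\text{and}\quad x_{im}\le x_{in}+\bar{x}_i\left(r_{it}-r_{it_{a(m,n)}}\right)\qquad\forall\, m,n\in S_t,\ t\in\mathcal{P},\ i\in\mathcal{I}.$$ That is, $(\mathbf{x},\mathbf{y},\mathbf{r})$ is feasible for $(AMS_\mu)$ if and only if it satisfies (A), (B), (D) and the displayed constraints.
   Context: A scenario tree $\mathcal{T}$ has $T$ stages, $\mathcal{P}=\{1,\dots,T\}$; every non-leaf node has $B$ children. $S_t$ is the set of nodes of stage $t$, $P(n)$ is the set of nodes on the path from the root to $n$ (inclusive), and $\mathcal{T}(l)$ is the subtree rooted at node $l$. The last common ancestor of $m,n$ is the node of largest stage in $P(m)\cap P(n)$. Node $n$ has probability $p_n$. At each node $n$ there are state variables $\mathbf{x}_n=(x_{1n},\dots,x_{In})$ and stage variables $\mathbf{y}_n$ (integer or continuous); $\mathcal{I}=\{1,\dots,I\}$. Data: $\mathbf{a}_n,\mathbf{b}_n,\mathbf{C}_{nm},\mathbf{D}_n,\mathbf{d}_n$ and local sets $\mathcal{X}_n,\mathcal{Y}_n$. State variables satisfy $0\le x_{in}\le\bar{x}_i$, where $\bar{x}_i$ is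 a given upper bound; these bounds are implied by $\mathbf{x}_n\in\mathcal{X}_n$. $(AMS_\mu)$, for $\mu\in\{0,\dots,T-1\}$: minimize $\sum_{n\in\mathcal{T}}p_n(\mathbf{a}_n^\top\mathbf{x}_n+\mathbf{b}_n^\top\mathbf{y}_n)$ over $(\mathbf{x},\mathbf{y},\mathbf{r})$ subject to (A) $\sum_{m\in P(n)}\mathbf{C}_{nm}\mathbf{x}_m+\mathbf{D}_n\mathbf{y}_n\ge\mathbf{d}_n$ for all $n\in\mathcal{T}$; (B) $\mathbf{x}_n\in\mathcal{X}_n,\ \mathbf{y}_n\in\mathcal{Y}_n$ for all $n\in\mathcal{T}$; (C) (non-anticipativity constraints) $x_{im}\ge x_{in}-\bar{x}_i(r_{it'}-r_{it})$ and $x_{im}\le x_{in}+\bar{x}_i(r_{it'}-r_{it})$ for all $m,n\in S_{t'}\cap\mathcal{T}(l)$, $l\in S_t$, $t'\ge t$, $t,t'\in\mathcal{P}$, $i\in\mathcal{I}$; (D) $r_{i1}\le r_{i2}\le\dots\le r_{iT}\le\mu$; $r_{i(t+1)}-r_{it}\le1$ for $t\in\{1,\dots,T-1\}$; $r_{i1}=0$; $r_{it}\in\mathbb{Z}_{+}$, for all $i\in\mathcal{I}$, $t\in\mathcal{P}$. *)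

theory Defs
  imports "HOL-Analysis.Analysis"
begin

text \<open>
  The tree is given by its parent function; \<open>parent\<close> is unconstrained at the root
  and outside \<open>nodes\<close>.
\<close>

record 'n scenario_tree =
  nodes :: "'n set"
  root_node :: "'n"
  parent :: "'n \<Rightarrow> 'n"
  stage :: "'n \<Rightarrow> nat"
  num_stages :: nat
  branching :: nat

definition children :: "'n scenario_tree \<Rightarrow> 'n \<Rightarrow> 'n set" where
  "children \<T> n = {m \<in> nodes \<T>. m \<noteq> root_node \<T> \<and> parent \<T> m = n}"

text \<open>
  Since the stage drops by one from a node to its parent and is at least 1, iterating
  \<open>parent\<close> from any node ends at the root.
\<close>

definition is_scenario_tree :: "'n scenario_tree \<Rightarrow> bool" where
  "is_scenario_tree \<T> \<longleftrightarrow>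
     finite (nodes \<T>) \<and>
     root_node \<T> \<in> nodes \<T> \<and> stage \<T> (root_node \<T>) = 1 \<and>
     (\<forall>n \<in> nodes \<T>. n \<noteq> root_node \<T> \<longrightarrow>
        parent \<T> n \<in> nodes \<T> \<and> stage \<T> n = stage \<T> (parent \<T> n) + 1) \<and>
     stage \<T> ` nodes \<T> = {1..num_stages \<T>} \<and>
     (\<forall>n \<in> nodes \<T>. children \<T> n \<noteq> {} \<longrightarrow> card (children \<T> n) = branching \<T>)"

definition stages :: "'n scenario_tree \<Rightarrow> nat set" where
  "stages \<T> = {1..num_stages \<T>}"

definition stage_nodes :: "'n scenario_tree \<Rightarrow> nat \<Rightarrow> 'n set" where
  "stage_nodes \<T> t = {n \<in> nodes \<T>. stage \<T> n = t}"

text \<open>A node of stage \<open>s\<close> is \<open>s - 1\<close> parent steps away from the root.\<close>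

definition path_nodes :: "'n scenario_tree \<Rightarrow> 'n \<Rightarrow> 'n set" where
  "path_nodes \<T> n = {(parent \<T> ^^ k) n | k. k < stage \<T> n}"

definition subtree :: "'n scenario_tree \<Rightarrow> 'n \<Rightarrow> 'n set" where
  "subtree \<T> l = {n \<in> nodes \<T>. l \<in> path_nodes \<T> n}"

definition last_common_ancestor :: "'n scenario_tree \<Rightarrow> 'n \<Rightarrow> 'n \<Rightarrow> 'n" where
  "last_common_ancestor \<T> m n =
     arg_max (stage \<T>) (\<lambda>a. a \<in> path_nodes \<T> m \<inter> path_nodes \<T> n)"

text \<open>
  The index type \<open>'i\<close> stands for the set of state variables, \<open>'j\<close> indexes the stage
  variables and \<open>'k\<close> the rows of the linear constraints of a node. Integrality of stage
  variables is part of \<open>Y_set\<close>. The cost vectors and node probabilities occur only in the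
  objective and have no influence on feasibility, so they are not part of the data.
\<close>

record ('n, 'i, 'j, 'k) ams_data =
  C_mat :: "'n \<Rightarrow> 'n \<Rightarrow> real ^ 'i ^ 'k"
  D_mat :: "'n \<Rightarrow> real ^ 'j ^ 'k"
  d_vec :: "'n \<Rightarrow> real ^ 'k"
  X_set :: "'n \<Rightarrow> (real ^ 'i) set"
  Y_set :: "'n \<Rightarrow> (real ^ 'j) set"
  x_bar :: "real ^ 'i"

definition state_bounds_implied ::
  "'n scenario_tree \<Rightarrow> ('n, 'i::finite, 'j::finite, 'k::finite) ams_data \<Rightarrow> bool" where
  "state_bounds_implied \<T> A \<longleftrightarrow>
     (\<forall>n \<in> nodes \<T>. \<forall>v \<in> X_set A n. \<forall>i. 0 \<le> v $ i \<and> v $ i \<le> x_bar A $ i)"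

text \<open>The order on vectors is componentwise.\<close>

definition linear_constraints ::
  "'n scenario_tree \<Rightarrow> ('n, 'i::finite, 'j::finite, 'k::finite) ams_data
    \<Rightarrow> ('n \<Rightarrow> real ^ 'i) \<Rightarrow> ('n \<Rightarrow> real ^ 'j) \<Rightarrow> bool" where
  "linear_constraints \<T> A x y \<longleftrightarrow>
     (\<forall>n \<in> nodes \<T>.
        (\<Sum>m \<in> path_nodes \<T> n. C_mat A n m *v x m) + D_mat A n *v y n \<ge> d_vec A n)"

definition local_constraints ::
  "'n scenario_tree \<Rightarrow> ('n, 'i::finite, 'j::finite, 'k::finite) ams_data
    \<Rightarrow> ('n \<Rightarrow> real ^ 'i) \<Rightarrow> ('n \<Rightarrow> real ^ 'j) \<Rightarrow> bool" where
  "local_constraints \<T> A x y \<longleftrightarrow> (\<forall>n \<in> nodes \<T>. x n \<in> X_set A n \<and> y n \<in> Y_set A n)"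

definition nonanticipativity ::
  "'n scenario_tree \<Rightarrow> ('n, 'i::finite, 'j::finite, 'k::finite) ams_data
    \<Rightarrow> ('n \<Rightarrow> real ^ 'i) \<Rightarrow> ('i \<Rightarrow> nat \<Rightarrow> int) \<Rightarrow> bool" where
  "nonanticipativity \<T> A x r \<longleftrightarrow>
     (\<forall>t \<in> stages \<T>. \<forall>t' \<in> stages \<T>. t' \<ge> t \<longrightarrow>
        (\<forall>l \<in> stage_nodes \<T> t.
         \<forall>m \<in> stage_nodes \<T> t' \<inter> subtree \<T> l. \<forall>n \<in> stage_nodes \<T> t' \<inter> subtree \<T> l. \<forall>i.
           x m $ i \<ge> x n $ i - x_bar A $ i * of_int (r i t' - r i t) \<and>
           x m $ i \<le> x n $ i + x_bar A $ i * of_int (r i t' - r i t)))"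

definition revision_constraints ::
  "'n scenario_tree \<Rightarrow> nat \<Rightarrow> ('i \<Rightarrow> nat \<Rightarrow> int) \<Rightarrow> bool" where
  "revision_constraints \<T> \<mu> r \<longleftrightarrow>
     (\<forall>i. (\<forall>t \<in> {1..<num_stages \<T>}. r i t \<le> r i (t + 1)) \<and>
          r i (num_stages \<T>) \<le> int \<mu> \<and>
          (\<forall>t \<in> {1..<num_stages \<T>}. r i (t + 1) - r i t \<le> 1) \<and>
          r i 1 = 0 \<and>
          (\<forall>t \<in> stages \<T>. r i t \<ge> 0))"

definition ams_feasible ::
  "'n scenario_tree \<Rightarrow> ('n, 'i::finite, 'j::finite, 'k::finite) ams_data \<Rightarrow> nat
    \<Rightarrow> ('n \<Rightarrow> real ^ 'i) \<Rightarrow> ('n \<Rightarrow> real ^ 'j) \<Rightarrow> ('i \<Rightarrow> nat \<Rightarrow> int) \<Rightarrow> bool" where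
  "ams_feasible \<T> A \<mu> x y r \<longleftrightarrow>
     linear_constraints \<T> A x y \<and> local_constraints \<T> A x y \<and>
     nonanticipativity \<T> A x r \<and> revision_constraints \<T> \<mu> r"

end

theory Submission
  imports Defs
begin

text \<open>
  The last common ancestor of two nodes is one of the nodes \<open>l\<close> admitted in (C), so the displayed
  constraints are instances of (C). Conversely, every common ancestor \<open>l\<close> has at most the stage of
  the last one; as \<open>r\<close> is nondecreasing in the stage and the upper bounds are nonnegative, the
  constraint for \<open>l\<close> is weaker than the one for the last common ancestor.
\<close>

text \<open>Induction on \<open>k\<close>: each parent step lowers the stage by exactly one, and
  \<open>k < stage \<T> n\<close> stops the walk at the root at the latest.\<close>

lemma ancestor_in_nodes:
  assumes "is_scenario_tree \<T>" "n \<in> nodes \<T>" "k < stage \<T> n"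
  shows "(parent \<T> ^^ k) n \<in> nodes \<T> \<and> stage \<T> ((parent \<T> ^^ k) n) + k = stage \<T> n"
  using assms(3)
proof (induction k)
  case 0
  then show ?case using assms(2) by simp
next
  case (Suc k)
  let ?a = "(parent \<T> ^^ k) n"
  from Suc have a: "?a \<in> nodes \<T>" "stage \<T> ?a + k = stage \<T> n" by auto
  \<comment> \<open>Since \<open>Suc k < stage \<T> n\<close>, the stage of \<open>?a\<close> is at
    least 2, whereas the root has stage 1.\<close>
  with Suc.prems assms(1) have "?a \<noteq> root_node \<T>"
    by (auto simp: is_scenario_tree_def)
  with a assms(1) have "parent \<T> ?a \<in> nodes \<T>" "stage \<T> ?a = stage \<T> (parent \<T> ?a) + 1"
    by (auto simp: is_scenario_tree_def)
  with a show ?case by simp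
qed

lemma path_nodes_D:
  assumes "is_scenario_tree \<T>" "n \<in> nodes \<T>" "a \<in> path_nodes \<T> n"
  shows "a \<in> nodes \<T>" "stage \<T> a \<le> stage \<T> n"
  using assms ancestor_in_nodes[OF assms(1,2)] by (fastforce simp: path_nodes_def)+

lemma stage_in_stages:
  assumes "is_scenario_tree \<T>" "n \<in> nodes \<T>"
  shows "stage \<T> n \<in> stages \<T>"
  using assms unfolding is_scenario_tree_def stages_def by blast

text \<open>Going up \<open>stage \<T> n - 1\<close> steps reaches stage 1, and a non-root node
  there would have a parent of stage 0. This gives any two nodes a common ancestor.\<close>

lemma root_in_path_nodes:
  assumes T: "is_scenario_tree \<T>" and n: "n \<in> nodes \<T>"
  shows "root_node \<T> \<in> path_nodes \<T> n"
proof -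
  let ?k = "stage \<T> n - 1" and ?a = "(parent \<T> ^^ (stage \<T> n - 1)) n"
  have k: "?k < stage \<T> n"
    using stage_in_stages[OF T n] by (simp add: stages_def)
  from ancestor_in_nodes[OF T n k] k have a: "?a \<in> nodes \<T>" "stage \<T> ?a = 1" by auto
  have "?a = root_node \<T>"
  proof (rule ccontr)
    assume "?a \<noteq> root_node \<T>"
    with a T have "parent \<T> ?a \<in> nodes \<T>" "stage \<T> (parent \<T> ?a) = 0"
      by (auto simp: is_scenario_tree_def)
    with stage_in_stages[OF T this(1)] show False by (simp add: stages_def)
  qed
  with k show ?thesis unfolding path_nodes_def by force
qed

lemma last_common_ancestor:
  assumes T: "is_scenario_tree \<T>" and m: "m \<in> nodes \<T>" and n: "n \<in> nodes \<T>"
  shows "last_common_ancestor \<T> m n \<in> path_nodes \<T> m \<inter> path_nodes \<T> n"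
    and "l \<in> path_nodes \<T> m \<inter> path_nodes \<T> n \<Longrightarrow>
      stage \<T> l \<le> stage \<T> (last_common_ancestor \<T> m n)"
proof -
  \<comment> \<open>\<open>arg_max\<close> is meaningful only for a satisfiable predicate with
    bounded values: the root is a witness, and paths never exceed the stage of their end node. The
    \<open>Suc\<close> makes the bound strict, as the \<open>arg_max\<close> rules expect.\<close>
  have bound: "\<forall>a. a \<in> path_nodes \<T> m \<inter> path_nodes \<T> n \<longrightarrow> stage \<T> a < Suc (stage \<T> m)"
    using path_nodes_D(2)[OF T m] by (auto simp: less_Suc_eq_le)
  show "last_common_ancestor \<T> m n \<in> path_nodes \<T> m \<inter> path_nodes \<T> n"
    unfolding last_common_ancestor_def
    by (rule arg_max_natI[OF _ bound, of "root_node \<T>"])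
      (use root_in_path_nodes[OF T] m n in blast)
  show "stage \<T> l \<le> stage \<T> (last_common_ancestor \<T> m n)"
    if "l \<in> path_nodes \<T> m \<inter> path_nodes \<T> n"
    unfolding last_common_ancestor_def by (rule arg_max_nat_le[OF that bound])
qed

text \<open>Chains the comparisons of consecutive stages in (D), which are available only between 1
  and \<open>num_stages \<T>\<close>.\<close>

lemma revision_constraints_mono:
  assumes "revision_constraints \<T> \<mu> r" "1 \<le> s" "s \<le> t" "t \<le> num_stages \<T>"
  shows "r i s \<le> r i t"
  using assms(3,4)
proof (induction t rule: dec_induct)
  case base
  then show ?case by simp
next
  case (step t)
  then have "r i t \<le> r i (t + 1)"
    using assms(1,2) unfolding revision_constraints_def by simp
  with step show ?case by simp
qed

text \<open>The point \<open>x n\<close> lies in \<open>X_set A n\<close>, so its entry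
  \<open>i\<close> is squeezed between 0 and the bound.\<close>

lemma x_bar_nonneg:
  assumes "state_bounds_implied \<T> A" "local_constraints \<T> A x y" "n \<in> nodes \<T>"
  shows "0 \<le> x_bar A $ i"
  using assms unfolding state_bounds_implied_def local_constraints_def by (meson order_trans)

theorem proposition6:
  fixes \<T> :: "'n scenario_tree"
    and A :: "('n, 'i::finite, 'j::finite, 'k::finite) ams_data"
    and \<mu> :: nat
    and x :: "'n \<Rightarrow> real ^ 'i"
    and y :: "'n \<Rightarrow> real ^ 'j"
    and r :: "'i \<Rightarrow> nat \<Rightarrow> int"
  assumes "is_scenario_tree \<T>"
    and "state_bounds_implied \<T> A"
    and "\<mu> \<in> {0..num_stages \<T> - 1}"
  shows "ams_feasible \<T> A \<mu> x y r \<longleftrightarrow>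
    linear_constraints \<T> A x y \<and> local_constraints \<T> A x y \<and> revision_constraints \<T> \<mu> r \<and>
    (\<forall>t \<in> stages \<T>. \<forall>m \<in> stage_nodes \<T> t. \<forall>n \<in> stage_nodes \<T> t. \<forall>i.
       x m $ i \<ge> x n $ i
         - x_bar A $ i * of_int (r i t - r i (stage \<T> (last_common_ancestor \<T> m n))) \<and>
       x m $ i \<le> x n $ i
         + x_bar A $ i * of_int (r i t - r i (stage \<T> (last_common_ancestor \<T> m n))))"
proof -
  note T = assms(1)
  let ?s = "\<lambda>m n. stage \<T> (last_common_ancestor \<T> m n)"
  let ?close = "\<lambda>m n i t s. x m $ i \<ge> x n $ i - x_bar A $ i * of_int (r i t - r i s) \<and>
    x m $ i \<le> x n $ i + x_bar A $ i * of_int (r i t - r i s)"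
  have "nonanticipativity \<T> A x r \<longleftrightarrow>
      (\<forall>t \<in> stages \<T>. \<forall>m \<in> stage_nodes \<T> t. \<forall>n \<in> stage_nodes \<T> t. \<forall>i. ?close m n i t (?s m n))"
    if local: "local_constraints \<T> A x y" and rev: "revision_constraints \<T> \<mu> r"
  proof (intro iffI ballI allI)
    fix t m n i
    assume C: "nonanticipativity \<T> A x r" and t: "t \<in> stages \<T>"
      and mn: "m \<in> stage_nodes \<T> t" "n \<in> stage_nodes \<T> t"
    let ?l = "last_common_ancestor \<T> m n"
    have nodes: "m \<in> nodes \<T>" "n \<in> nodes \<T>" "stage \<T> m = t"
      using mn by (auto simp: stage_nodes_def)
    have path: "?l \<in> path_nodes \<T> m" "?l \<in> path_nodes \<T> n"
      using last_common_ancestor(1)[OF T nodes(1,2)] by auto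
    note l = path_nodes_D[OF T nodes(1) path(1)]
    \<comment> \<open>These are the side conditions of (C) for the stage pair \<open>?s m n\<close>,
      \<open>t\<close> and the subtree root \<open>?l\<close>.\<close>
    have "?s m n \<in> stages \<T>" "?s m n \<le> t" "?l \<in> stage_nodes \<T> (?s m n)"
      "m \<in> stage_nodes \<T> t \<inter> subtree \<T> ?l" "n \<in> stage_nodes \<T> t \<inter> subtree \<T> ?l"
      using stage_in_stages[OF T l(1)] l nodes mn path by (auto simp: stage_nodes_def subtree_def)
    with C t show "?close m n i t (?s m n)"
      unfolding nonanticipativity_def by blast
  next
    assume R: "\<forall>t \<in> stages \<T>. \<forall>m \<in> stage_nodes \<T> t. \<forall>n \<in> stage_nodes \<T> t. \<forall>i.
      ?close m n i t (?s m n)"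
    have "?close m n i t' t"
      if t: "t \<in> stages \<T>" "t' \<in> stages \<T>" and l: "l \<in> stage_nodes \<T> t"
        and m: "m \<in> stage_nodes \<T> t' \<inter> subtree \<T> l"
        and n: "n \<in> stage_nodes \<T> t' \<inter> subtree \<T> l" for t t' l m n i
    proof -
      have nodes: "m \<in> nodes \<T>" "n \<in> nodes \<T>"
        using m n by (auto simp: stage_nodes_def)
      \<comment> \<open>Both nodes lie in the subtree of \<open>l\<close>, so \<open>l\<close> is a
        common ancestor, of stage \<open>t\<close>.\<close>
      have "t \<le> ?s m n"
        using last_common_ancestor(2)[OF T nodes, of l] l m n
        by (auto simp: stage_nodes_def subtree_def)
      moreover have "?s m n \<in> stages \<T>"
        using last_common_ancestor(1)[OF T nodes] path_nodes_D(1)[OF T nodes(1)]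
          stage_in_stages[OF T] by blast
      ultimately have "r i t \<le> r i (?s m n)"
        using revision_constraints_mono[OF rev] t(1) by (simp add: stages_def)
      \<comment> \<open>The slack allowed by (C) for \<open>l\<close> is at least the slack for the
        last common ancestor.\<close>
      then have "x_bar A $ i * of_int (r i t' - r i (?s m n)) \<le> x_bar A $ i * of_int (r i t' - r i t)"
        using x_bar_nonneg[OF assms(2) local nodes(1)] by (intro mult_left_mono) auto
      moreover have "?close m n i t' (?s m n)"
        using R t(2) m n by blast
      ultimately show ?thesis by linarith
    qed
    then show "nonanticipativity \<T> A x r"
      unfolding nonanticipativity_def by blast
  qed
  then show ?thesis
    unfolding ams_feasible_def by blast
qed

end
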